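(* Let $(x,y,\theta,\alpha\equiv a,v)$ be a solution of Problem (OC) with associated multipliers, and suppose the optimal control is singular over an interval $[\zeta_1,\zeta_2]\subset[0,t_f]$ with $\zeta_1<\zeta_2$, so that the singular control there is $v(t)=0$. Then this singular control is of order one (i.e. $k=1$) and satisfies the generalized Legendre--Clebsch condition, that is, $$(-1)^k\,\frac{\partial}{\partial v}\,\frac{d^{2k}}{dt^{2k}}H_v[t]\ \ge 0\qquad\text{with }k=1,\ \text{ for all } t\in[\zeta_1,\zeta_2].$$
   Context: Problem (OC): given $(x_0,y_0,\theta_0),(x_f,y_f,\theta_f)$ and $t_f>\|(x_0,y_0)-(x_f,y_f)\|$, minimize $\int_0^{t_f}\alpha(t)\,dt$ over measurable controls $v$ with $|v(t)|\le1$ a.e. and states satisfying $\dot x=\cos\theta$, $\dot y=\sin\theta$, $\dot\theta=\alpha v$, $\dot\alpha=0$ a.e. on $[0,t_f]$, with $(x,y,\theta)(0)=(x_0,y_0,\theta_0)$, $(x,y,\theta)(t_f)=(x_f,y_f,\theta_f)$ (angles modulo $2\pi$), where $\alpha\equiv a>0$ is an unknown constant. Hamiltonian: $H=\lambda_0\alpha+\lambda_1\cos\theta+\lambda_2\sin\theta+\lambda_3\alpha v+\lambda_4\cdot0$; $H[t]$ denotes its value along the solution and multipliers, $H_v=\partial H/\partial v=\alpha\lambda_3$. Multipliers furnished by the maximum principle: $\lambda_0\ge0$ and $\lambda_1,\dots,\lambda_4\in W^{1,\infty}(0,t_f;\mathbb R)$ with $(\lambda_0,\lambda_1(t),\dots,\lambda_4(t))\ne0$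 for every $t$, $\lambda_1\equiv\overline\lambda_1$ and $\lambda_2\equiv\overline\lambda_2$ constant, $\dot\lambda_3=\overline\lambda_1\sin\theta-\overline\lambda_2\cos\theta$, $\dot\lambda_4=-\lambda_0-\lambda_3v$, $\lambda_4(0)=\lambda_4(t_f)=0$, $H[t]=h$ constant, and $v(t)\in\operatorname{argmin}_{|w|\le1}a\lambda_3(t)w$ for a.e. $t$. The multipliers are normalized so that $\lambda_0=1$ (the problem is normal). It is assumed that $\overline\lambda_1+\mathbf i\overline\lambda_2\neq0$, with modulus $\rho>0$ and argument $\phi\in[0,2\pi)$, so $\dot\lambda_3=\rho\sin(\theta-\phi)$. The control is singular over $[\zeta_1,\zeta_2]$ if $\lambda_3(t)=0$ for a.e. $t\in[\zeta_1,\zeta_2]$. The order of singularity is the integer $k$ such that $2k$ is the number of times $H_v$ must be differentiated with respect to $t$ (using the state and adjoint equations) until the control $v$ appears explicitly for the first time; $\frac{\partial}{\partial v}\frac{d^{2k}}{dt^{2k}}H_v[t]$ is the partial derivative with respect to $v$ of the resulting expression, evaluated along the solution. Functions are identified when they agree a.e. *)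

theory Defs
  imports "HOL-Analysis.Analysis" "HOL-Library.Real_Mod"
begin

text \<open>
  States are \<open>(x, y, \<theta>, \<alpha>)\<close> and costates are \<open>(\<lambda>\<^sub>1, \<lambda>\<^sub>2, \<lambda>\<^sub>3, \<lambda>\<^sub>4)\<close>, where
  \<open>\<lambda>\<^sub>i\<close> is the multiplier of the \<open>i\<close>-th state equation. Angles are real-valued;
  only the boundary conditions are read modulo \<open>2 * pi\<close>.
\<close>

type_synonym state = "real \<times> real \<times> real \<times> real"
type_synonym costate = "real \<times> real \<times> real \<times> real"

definition alpha :: "state \<Rightarrow> real" where
  "alpha = (\<lambda>(x, y, \<theta>, \<alpha>). \<alpha>)"

definition lam3 :: "costate \<Rightarrow> real" where
  "lam3 = (\<lambda>(l1, l2, l3, l4). l3)"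

definition lam4 :: "costate \<Rightarrow> real" where
  "lam4 = (\<lambda>(l1, l2, l3, l4). l4)"

definition dynamics :: "state \<Rightarrow> real \<Rightarrow> state" where
  "dynamics = (\<lambda>(x, y, \<theta>, \<alpha>) v. (cos \<theta>, sin \<theta>, \<alpha> * v, 0))"

definition boundary_cond :: "state \<Rightarrow> real \<times> real \<times> real \<Rightarrow> bool" where
  "boundary_cond = (\<lambda>(x, y, \<theta>, \<alpha>) (x', y', \<theta>'). x = x' \<and> y = y' \<and> [\<theta> = \<theta>'] (rmod (2 * pi)))"

text \<open>
  \<open>ae_trajectory T Z F\<close>: \<open>Z\<close> belongs to \<open>W\<^sup>1\<^sup>,\<^sup>\<infinity>\<close> on \<open>[0, T]\<close>, i.e. it is Lipschitz there,
  and satisfies \<open>Z' = F\<close> almost everywhere. Since the controls and the multipliers are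
  bounded, the right-hand sides used below are bounded along absolutely continuous
  solutions, so asking for Lipschitz rather than absolutely continuous trajectories
  excludes nothing.
\<close>

definition ae_trajectory :: "real \<Rightarrow> (real \<Rightarrow> 'a::euclidean_space) \<Rightarrow> (real \<Rightarrow> 'a) \<Rightarrow> bool" where
  "ae_trajectory T Z F \<longleftrightarrow>
     (\<exists>L. L-lipschitz_on {0..T} Z) \<and>
     (AE t in lebesgue_on {0..T}. (Z has_vector_derivative F t) (at t within {0..T}))"

definition OC_feasible ::
  "real \<times> real \<times> real \<Rightarrow> real \<times> real \<times> real \<Rightarrow> real \<Rightarrow> (real \<Rightarrow> state) \<times> (real \<Rightarrow> real) \<Rightarrow> bool" where
  "OC_feasible p0 pf T = (\<lambda>(X, v).
     v \<in> borel_measurable (lebesgue_on {0..T}) \<and>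
     (AE t in lebesgue_on {0..T}. \<bar>v t\<bar> \<le> 1) \<and>
     ae_trajectory T X (\<lambda>t. dynamics (X t) (v t)) \<and>
     boundary_cond (X 0) p0 \<and> boundary_cond (X T) pf \<and>
     (\<exists>a>0. \<forall>t\<in>{0..T}. alpha (X t) = a))"

definition OC_cost :: "real \<Rightarrow> (real \<Rightarrow> state) \<times> (real \<Rightarrow> real) \<Rightarrow> real" where
  "OC_cost T = (\<lambda>(X, v). integral {0..T} (\<lambda>t. alpha (X t)))"

definition OC_solution ::
  "real \<times> real \<times> real \<Rightarrow> real \<times> real \<times> real \<Rightarrow> real \<Rightarrow> (real \<Rightarrow> state) \<Rightarrow> (real \<Rightarrow> real) \<Rightarrow> bool" where
  "OC_solution p0 pf T X v \<longleftrightarrow> is_arg_min (OC_cost T) (OC_feasible p0 pf T) (X, v)"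

definition hamiltonian :: "real \<Rightarrow> state \<times> costate \<Rightarrow> real \<Rightarrow> real" where
  "hamiltonian l0 = (\<lambda>((x, y, \<theta>, \<alpha>), (l1, l2, l3, l4)) v.
     l0 * \<alpha> + l1 * cos \<theta> + l2 * sin \<theta> + l3 * \<alpha> * v + l4 * 0)"

definition adjoint_rhs :: "real \<Rightarrow> state \<times> costate \<Rightarrow> real \<Rightarrow> costate" where
  "adjoint_rhs l0 = (\<lambda>((x, y, \<theta>, \<alpha>), (l1, l2, l3, l4)) v.
     (0, 0, l1 * sin \<theta> - l2 * cos \<theta>, - l0 - l3 * v))"

text \<open>
  The conditions of the maximum principle; \<open>c1\<close> and \<open>c2\<close> are the constant values of
  \<open>\<lambda>\<^sub>1\<close> and \<open>\<lambda>\<^sub>2\<close>. The Hamiltonian is constant only up to null sets, because \<open>v\<close> is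
  determined only up to null sets.
\<close>

definition OC_multipliers ::
  "real \<Rightarrow> (real \<Rightarrow> state) \<Rightarrow> (real \<Rightarrow> real) \<Rightarrow> real \<Rightarrow> real \<Rightarrow> real \<Rightarrow> (real \<Rightarrow> costate) \<Rightarrow> bool" where
  "OC_multipliers T X v l0 c1 c2 P \<longleftrightarrow>
     l0 \<ge> 0 \<and>
     (\<forall>t\<in>{0..T}. (l0, P t) \<noteq> 0) \<and>
     (\<forall>t\<in>{0..T}. fst (P t) = c1 \<and> fst (snd (P t)) = c2) \<and>
     ae_trajectory T P (\<lambda>t. adjoint_rhs l0 (X t, P t) (v t)) \<and>
     lam4 (P 0) = 0 \<and> lam4 (P T) = 0 \<and>
     (\<exists>h. AE t in lebesgue_on {0..T}. hamiltonian l0 (X t, P t) (v t) = h) \<and>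
     (AE t in lebesgue_on {0..T}.
        is_arg_min (\<lambda>w. alpha (X t) * lam3 (P t) * w) (\<lambda>w. \<bar>w\<bar> \<le> 1) (v t))"

definition singular_over :: "(real \<Rightarrow> costate) \<Rightarrow> real \<Rightarrow> real \<Rightarrow> bool" where
  "singular_over P \<zeta>1 \<zeta>2 \<longleftrightarrow> (AE t in lebesgue_on {\<zeta>1..\<zeta>2}. lam3 (P t) = 0)"

text \<open>
  \<open>Hv_deriv l0 j z v\<close> is the expression obtained from \<open>\<partial>H/\<partial>v\<close> by \<open>j\<close> differentiations
  with respect to time in which the time derivatives of states and costates are replaced
  using the state and adjoint equations. The recursion omits the \<open>\<partial>/\<partial>v\<close> part of the total
  derivative, so it has this meaning only as long as the expressions being differentiated
  (stages \<open>0, \<dots>, j - 1\<close>) are free of \<open>v\<close>, as \<open>singular_order\<close> requires.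
\<close>

primrec Hv_deriv :: "real \<Rightarrow> nat \<Rightarrow> state \<times> costate \<Rightarrow> real \<Rightarrow> real" where
  "Hv_deriv l0 0 = (\<lambda>z v. deriv (hamiltonian l0 z) v)"
| "Hv_deriv l0 (Suc j) = (\<lambda>z v.
     frechet_derivative (\<lambda>z'. Hv_deriv l0 j z' v) (at z)
       (dynamics (fst z) v, adjoint_rhs l0 z v))"

text \<open>
  The control is singular of order \<open>k\<close> along \<open>(X, P)\<close> on \<open>I\<close>: stages \<open>0, \<dots>, 2 * k - 1\<close> do
  not contain \<open>v\<close> at all, whereas stage \<open>2 * k\<close> genuinely depends on \<open>v\<close> at each point of
  the arc.
\<close>

definition singular_order ::
  "real \<Rightarrow> (real \<Rightarrow> state) \<Rightarrow> (real \<Rightarrow> costate) \<Rightarrow> real set \<Rightarrow> nat \<Rightarrow> bool" where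
  "singular_order l0 X P I k \<longleftrightarrow>
     (\<forall>j<2 * k. \<forall>z w w'. Hv_deriv l0 j z w = Hv_deriv l0 j z w') \<and>
     (\<forall>t\<in>I. \<exists>w w'. Hv_deriv l0 (2 * k) (X t, P t) w \<noteq> Hv_deriv l0 (2 * k) (X t, P t) w')"

definition generalized_Legendre_Clebsch ::
  "real \<Rightarrow> (real \<Rightarrow> state) \<Rightarrow> (real \<Rightarrow> real) \<Rightarrow> (real \<Rightarrow> costate) \<Rightarrow> real set \<Rightarrow> nat \<Rightarrow> bool" where
  "generalized_Legendre_Clebsch l0 X v P I k \<longleftrightarrow>
     (\<forall>t\<in>I. (- 1) ^ k * deriv (Hv_deriv l0 (2 * k) (X t, P t)) (v t) \<ge> 0)"

end

theory Submission
  imports Defs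
begin

text \<open>
  Write \<open>s = c1 * cos \<theta> + c2 * sin \<theta>\<close> and let \<open>\<rho>\<close> be the modulus of \<open>Complex c1 c2\<close>. Two
  differentiations turn \<open>H_v = \<alpha> * \<lambda>\<^sub>3\<close> into \<open>\<alpha>\<^sup>2 * s * v\<close>, so order one means \<open>s \<noteq> 0\<close> on the
  arc, and the generalized Legendre--Clebsch condition means \<open>s \<le> 0\<close> there.

  On the arc \<open>\<lambda>\<^sub>3\<close> vanishes identically, and so does its derivative \<open>c1 * sin \<theta> - c2 * cos \<theta>\<close>,
  first almost everywhere and then by continuity (\<open>continuous_AE_const_imp_const\<close>).
  The squares of this quantity and of \<open>s\<close> add up to \<open>\<rho>\<^sup>2\<close>, hence \<open>s = \<rho>\<close> or \<open>s = - \<rho>\<close>.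
  Differentiating once more gives \<open>s * a * v = 0\<close>, and therefore \<open>v = 0\<close>, almost everywhere on the
  arc.

  The sign of \<open>s\<close> is a global matter: it is decided by the boundary values
  \<open>\<lambda>\<^sub>4(0) = \<lambda>\<^sub>4(tf) = 0\<close>. Eliminating \<open>\<lambda>\<^sub>3 * v\<close> between the adjoint equation
  \<open>\<lambda>\<^sub>4' = - 1 - \<lambda>\<^sub>3 * v\<close> and the constancy \<open>a + s + a * \<lambda>\<^sub>3 * v = h\<close> of the Hamiltonian leaves
  \<open>a * \<lambda>\<^sub>4' = s - h\<close> on the whole of \<open>[0, tf]\<close>. If \<open>s = \<rho>\<close> somewhere on the arc, then
  \<open>h = a + \<rho>\<close>, so \<open>a * \<lambda>\<^sub>4' \<le> - a < 0\<close> almost everywhere and \<open>\<lambda>\<^sub>4(tf) < \<lambda>\<^sub>4(0)\<close>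
  (\<open>lipschitz_strict_decrease\<close>), a contradiction. Hence \<open>s = - \<rho> < 0\<close> on the arc.
\<close>

section \<open>Properties that hold almost everywhere on an interval\<close>

lemma AE_lebesgue_on_interval_iff_negligible:
  fixes a b :: real
  shows "(AE t in lebesgue_on {a..b}. Q t) \<longleftrightarrow> negligible {t\<in>{a..b}. \<not> Q t}"
proof -
  have "(AE t in lebesgue_on {a..b}. Q t) \<longleftrightarrow> (AE t in lebesgue. t \<in> {a..b} \<longrightarrow> Q t)"
    by (intro AE_restrict_space_iff) auto
  also have "\<dots> \<longleftrightarrow> negligible {t. \<not> (t \<in> {a..b} \<longrightarrow> Q t)}"
    by (auto simp: completion.AE_iff_null_sets negligible_iff_null_sets null_sets_completion_subset)
  also have "{t. \<not> (t \<in> {a..b} \<longrightarrow> Q t)} = {t\<in>{a..b}. \<not> Q t}"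
    by auto
  finally show ?thesis .
qed

lemma AE_lebesgue_on_subinterval:
  fixes a b c d :: real
  assumes "AE t in lebesgue_on {a..b}. Q t" "{c..d} \<subseteq> {a..b}"
  shows "AE t in lebesgue_on {c..d}. Q t"
  using assms unfolding AE_lebesgue_on_interval_iff_negligible
  by (elim negligible_subset) auto

lemma AE_lebesgue_on_witness:
  fixes a b c d :: real
  assumes "AE t in lebesgue_on {a..b}. Q t" "a \<le> c" "c < d" "d \<le> b"
  obtains t where "c < t" "t < d" "Q t"
proof -
  have "\<not> negligible {c<..<d}"
    using \<open>c < d\<close> by (intro open_not_negligible) auto
  then have "\<not> {c<..<d} \<subseteq> {t\<in>{a..b}. \<not> Q t}"
    using assms(1) negligible_subset unfolding AE_lebesgue_on_interval_iff_negligible by blast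
  then obtain t where "t \<in> {c<..<d}" "t \<notin> {t\<in>{a..b}. \<not> Q t}"
    by blast
  then show ?thesis using that assms(2,4) by auto
qed

text \<open>
  The set where the equation holds is closed by continuity, and dense because its complement is null
  and so contains no interval. This is how the almost everywhere hypotheses on the arc (singularity,
  adjoint equation, constant Hamiltonian) become statements about each of its points, endpoints
  included.
\<close>

lemma continuous_AE_const_imp_const:
  fixes a b k :: real and f :: "real \<Rightarrow> real"
  assumes ae: "AE t in lebesgue_on {a..b}. f t = k"
    and cont: "continuous_on {a..b} f" and "a < b" and "t \<in> {a..b}"
  shows "f t = k"
proof -
  have "{a<..<b} \<subseteq> closure {u\<in>{a..b}. f u = k}"
  proof
    fix u assume u: "u \<in> {a<..<b}"
    show "u \<in> closure {u\<in>{a..b}. f u = k}"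
      unfolding closure_approachable
    proof (intro allI impI)
      fix e :: real assume "e > 0"
      with u have "a \<le> u" "u < min b (u + e)" "min b (u + e) \<le> b" by auto
      from AE_lebesgue_on_witness[OF ae this] obtain w where
        "u < w" "w < min b (u + e)" "f w = k" .
      with u show "\<exists>y\<in>{u\<in>{a..b}. f u = k}. dist y u < e"
        by (intro bexI[of _ w]) (auto simp: dist_real_def)
    qed
  qed
  then have "closure {a<..<b} \<subseteq> closure {u\<in>{a..b}. f u = k}"
    by (simp add: closure_minimal)
  moreover have "closed {u\<in>{a..b}. f u = k}"
    using continuous_closed_preimage_constant[OF cont, of k] by simp
  ultimately show ?thesis
    using assms(3,4) by (auto simp: closure_closed)
qed

section \<open>Lipschitz functions with almost everywhere negative derivative\<close>

text \<open>
  A Lipschitz map sends the exceptional null set to a null set, so if the function increased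
  somewhere, some intermediate value would be taken at regular points only. At the last point where
  the function is still below that value it would have a nonnegative derivative.
\<close>

lemma lipschitz_AE_negative_deriv_antimono:
  fixes f :: "real \<Rightarrow> real"
  assumes lip: "L-lipschitz_on {a..b} f"
    and ae: "AE t in lebesgue_on {a..b}. \<exists>D<0. (f has_real_derivative D) (at t within {a..b})"
    and st: "a \<le> s" "s \<le> t" "t \<le> b"
  shows "f t \<le> f s"
proof (rule ccontr)
  assume "\<not> f t \<le> f s"
  then have less: "f s < f t" by simp
  define N where "N = {t\<in>{a..b}. \<not> (\<exists>D<0. (f has_real_derivative D) (at t within {a..b}))}"
  have "negligible (f ` N)"
  proof (rule negligible_locally_Lipschitz_image)
    show "negligible N"
      using ae unfolding N_def AE_lebesgue_on_interval_iff_negligible .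
    fix x assume x: "x \<in> N"
    have "norm (f y - f x) \<le> L * norm (y - x)" if "y \<in> N" for y
      using lipschitz_onD[OF lip, of y x] that x by (auto simp: N_def dist_norm)
    then show "\<exists>T B. open T \<and> x \<in> T \<and> (\<forall>y\<in>N \<inter> T. norm (f y - f x) \<le> B * norm (y - x))"
      by (intro exI[of _ UNIV] exI[of _ L]) auto
  qed simp
  moreover have "\<not> negligible {f s<..<f t}"
    using less by (intro open_not_negligible) auto
  ultimately have "\<not> {f s<..<f t} \<subseteq> f ` N"
    using negligible_subset by blast
  then obtain c where c: "f s < c" "c < f t" "c \<notin> f ` N"
    by (metis greaterThanLessThan_iff subsetI)
  have cont: "continuous_on {a..b} f"
    using lip by (rule lipschitz_on_continuous_on)
  have cont_st: "continuous_on {s..t} f"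
    by (rule continuous_on_subset[OF cont]) (use st in auto)
  define K where "K = {r\<in>{s..t}. f r \<le> c}"
  have "closed K"
    unfolding K_def
    using continuous_on_closed_Collect_le[OF cont_st, of "\<lambda>_. c"] by simp
  then have "compact K"
    unfolding compact_eq_bounded_closed
    by (auto simp: K_def intro: bounded_subset[OF bounded_closed_interval[of s t]])
  moreover have "K \<noteq> {}"
    using c(1) st(2) by (auto simp: K_def)
  ultimately obtain u where u: "u \<in> K" and u_max: "\<And>r. r \<in> K \<Longrightarrow> r \<le> u"
    by (meson compact_attains_sup)
  have u_le: "s \<le> u" "u \<le> t" "f u \<le> c"
    using u by (auto simp: K_def)
  have "continuous_on {u..t} f"
    by (rule continuous_on_subset[OF cont_st]) (use u_le in auto)
  then obtain w where w: "u \<le> w" "w \<le> t" "f w = c"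
    using IVT'[of f u c t] u_le c(2) by auto
  then have "w \<in> K"
    using u_le by (auto simp: K_def)
  with u_max w have "f u = c"
    by force
  then have "u \<notin> N" "u < t"
    using c u_le by (auto simp: less_le)
  then obtain D where "D < 0" and D: "(f has_real_derivative D) (at u within {a..b})"
    using u_le st by (auto simp: N_def)
  obtain d where d: "d > 0" "\<And>h. h > 0 \<Longrightarrow> u + h \<in> {a..b} \<Longrightarrow> h < d \<Longrightarrow> f (u + h) < f u"
    using has_real_derivative_neg_dec_right[OF D \<open>D < 0\<close>] by auto
  define h where "h = min (d / 2) (t - u)"
  have h: "h > 0" "h < d" "u + h \<le> t"
    using d(1) \<open>u < t\<close> by (auto simp: h_def)
  then have "f (u + h) < f u"
    using d(2)[of h] u_le st by auto
  then have "u + h \<in> K"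
    using u_le h by (auto simp: K_def)
  with u_max h(1) show False
    by force
qed

text \<open>
  A function that is already known to be nonincreasing drops strictly just after any one point with
  negative derivative, and it cannot recover afterwards.
\<close>

lemma lipschitz_strict_decrease:
  fixes f :: "real \<Rightarrow> real"
  assumes lip: "L-lipschitz_on {a..b} f"
    and ae: "AE t in lebesgue_on {a..b}. \<exists>D<0. (f has_real_derivative D) (at t within {a..b})"
    and "a < b"
  shows "f b < f a"
proof -
  note anti = lipschitz_AE_negative_deriv_antimono[OF lip ae]
  obtain p D where p: "a < p" "p < b" and "D < 0"
    and D: "(f has_real_derivative D) (at p within {a..b})"
    using AE_lebesgue_on_witness[OF ae order_refl \<open>a < b\<close> order_refl] by blast
  obtain d where d: "d > 0" "\<And>h. h > 0 \<Longrightarrow> p + h \<in> {a..b} \<Longrightarrow> h < d \<Longrightarrow> f (p + h) < f p"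
    using has_real_derivative_neg_dec_right[OF D \<open>D < 0\<close>] by auto
  define h where "h = min (d / 2) (b - p)"
  have h: "h > 0" "h < d" "p + h \<le> b"
    using d(1) p by (auto simp: h_def)
  have "f b \<le> f (p + h)"
    using anti[of "p + h" b] h p by auto
  also have "\<dots> < f p"
    using d(2)[of h] h p by auto
  also have "\<dots> \<le> f a"
    using anti[of a p] p by auto
  finally show ?thesis .
qed

section \<open>Time derivatives of the switching function\<close>

text \<open>
  Trajectories are differentiable relative to the whole time interval, whereas the functions to be
  differentiated vanish only on the arc; strictly inside the arc the two viewpoints agree.
\<close>

lemma zero_on_subinterval_imp_zero_deriv:
  fixes g :: "real \<Rightarrow> real"
  assumes g: "(g has_real_derivative D) (at t within {a..b})"
    and "{c..d} \<subseteq> {a..b}" "c < t" "t < d" "\<And>u. u \<in> {c..d} \<Longrightarrow> g u = 0"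
  shows "D = 0"
proof -
  have "(g has_real_derivative D) (at t within {c<..<d})"
    by (rule DERIV_subset[OF g]) (use assms(2) in auto)
  then have "(g has_real_derivative D) (at t)"
    using assms(3,4) by (simp add: at_within_open[of t "{c<..<d}"])
  moreover have "(g has_real_derivative 0) (at t)"
  proof (rule DERIV_cong_ev[THEN iffD2])
    show "\<forall>\<^sub>F u in nhds t. g u = 0"
      using eventually_nhds_in_open[of "{c<..<d}" t] assms(3-5)
      by (auto elim: eventually_mono)
  qed auto
  ultimately show ?thesis
    by (rule DERIV_unique)
qed

lemma Hv_deriv_0: "Hv_deriv l0 0 ((x, y, \<theta>, \<alpha>), (l1, l2, l3, l4)) w = \<alpha> * l3"
proof -
  have "((\<lambda>w. hamiltonian l0 ((x, y, \<theta>, \<alpha>), (l1, l2, l3, l4)) w) has_real_derivative \<alpha> * l3) (at w)"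
    unfolding hamiltonian_def by (auto intro!: derivative_eq_intros)
  then show ?thesis
    by (simp add: DERIV_imp_deriv)
qed

text \<open>
  Stage one is \<open>\<alpha> * \<lambda>\<^sub>3'\<close>, and the adjoint equation for \<open>\<lambda>\<^sub>3\<close> is free of the control. It depends
  on \<open>\<theta>\<close>, however, so that \<open>w\<close> enters at stage two through \<open>\<theta>' = \<alpha> * w\<close>.
\<close>

lemma Hv_deriv_1:
  "Hv_deriv l0 1 ((x, y, \<theta>, \<alpha>), (l1, l2, l3, l4)) w = \<alpha> * (l1 * sin \<theta> - l2 * cos \<theta>)"
proof -
  let ?z = "((x, y, \<theta>, \<alpha>), (l1, l2, l3, l4))"
  have "(\<lambda>z'. Hv_deriv l0 0 z' w)
      = (\<lambda>z. snd (snd (snd (fst z))) * fst (snd (snd (snd z))))"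
    by (auto simp: fun_eq_iff Hv_deriv_0 simp del: Hv_deriv.simps)
  moreover have "((\<lambda>z. snd (snd (snd (fst z))) * fst (snd (snd (snd z))) :: real) has_derivative
      (\<lambda>d. snd (snd (snd (fst d))) * l3 + \<alpha> * fst (snd (snd (snd d))))) (at ?z)"
    by (auto intro!: derivative_eq_intros)
  ultimately show ?thesis
    unfolding One_nat_def Hv_deriv.simps(2)
    by (simp add: frechet_derivative_at[symmetric] dynamics_def adjoint_rhs_def)
qed

lemma Hv_deriv_2:
  "Hv_deriv l0 2 ((x, y, \<theta>, \<alpha>), (l1, l2, l3, l4)) w = \<alpha>\<^sup>2 * (l1 * cos \<theta> + l2 * sin \<theta>) * w"
proof -
  let ?z = "((x, y, \<theta>, \<alpha>), (l1, l2, l3, l4))"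
  let ?th = "\<lambda>z :: state \<times> costate. fst (snd (snd (fst z)))"
  let ?al = "\<lambda>z :: state \<times> costate. snd (snd (snd (fst z)))"
  let ?g = "\<lambda>z. ?al z * (fst (snd z) * sin (?th z) - fst (snd (snd z)) * cos (?th z))"
  have "(\<lambda>z'. Hv_deriv l0 (Suc 0) z' w) = ?g"
    by (auto simp: fun_eq_iff Hv_deriv_1[unfolded One_nat_def] simp del: Hv_deriv.simps)
  moreover have "(?g has_derivative (\<lambda>d. ?al d * (l1 * sin \<theta> - l2 * cos \<theta>)
      + \<alpha> * (fst (snd d) * sin \<theta> - fst (snd (snd d)) * cos \<theta>
             + (l1 * cos \<theta> + l2 * sin \<theta>) * ?th d))) (at ?z)"
    by (auto intro!: derivative_eq_intros simp: fun_eq_iff algebra_simps)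
  ultimately show ?thesis
    unfolding numeral_2_eq_2 Hv_deriv.simps(2)[of l0 "Suc 0"]
    by (simp add: frechet_derivative_at[symmetric] dynamics_def adjoint_rhs_def power2_eq_square
        del: Hv_deriv.simps)
qed

section \<open>The singular arc\<close>

theorem proposition14:
  fixes x0 y0 \<theta>0 xf yf \<theta>f tf l0 c1 c2 \<zeta>1 \<zeta>2 :: real
    and X :: "real \<Rightarrow> state" and v :: "real \<Rightarrow> real" and P :: "real \<Rightarrow> costate"
  assumes "tf > dist (x0, y0) (xf, yf)"
    and "OC_solution (x0, y0, \<theta>0) (xf, yf, \<theta>f) tf X v"
    and "OC_multipliers tf X v l0 c1 c2 P"
    and "l0 = 1"
    and "Complex c1 c2 \<noteq> 0"
    and "0 \<le> \<zeta>1" and "\<zeta>1 < \<zeta>2" and "\<zeta>2 \<le> tf"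
    and "singular_over P \<zeta>1 \<zeta>2"
  shows "(AE t in lebesgue_on {\<zeta>1..\<zeta>2}. v t = 0) \<and>
         singular_order l0 X P {\<zeta>1..\<zeta>2} 1 \<and>
         generalized_Legendre_Clebsch l0 X v P {\<zeta>1..\<zeta>2} 1"
proof -
  have "tf > 0"
    using assms(6-8) by linarith
  have arc: "{\<zeta>1..\<zeta>2} \<subseteq> {0..tf}"
    using assms(6-8) by auto
  define \<theta> where "\<theta> t = fst (snd (snd (X t)))" for t
  \<comment> \<open>\<open>\<mu>3\<close> and \<open>\<mu>4\<close> are the multipliers \<open>\<lambda>\<^sub>3\<close> and \<open>\<lambda>\<^sub>4\<close>; \<open>q\<close> is the right-hand side of the
    adjoint equation for \<open>\<lambda>\<^sub>3\<close>, and \<open>s\<close> is its derivative with respect to \<open>\<theta>\<close>.\<close>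
  define \<mu>3 where "\<mu>3 t = fst (snd (snd (P t)))" for t
  define \<mu>4 where "\<mu>4 t = snd (snd (snd (P t)))" for t
  define s where "s t = c1 * cos (\<theta> t) + c2 * sin (\<theta> t)" for t
  define q where "q t = c1 * sin (\<theta> t) - c2 * cos (\<theta> t)" for t
  define \<rho> where "\<rho> = norm (Complex c1 c2)"

  have "OC_feasible (x0, y0, \<theta>0) (xf, yf, \<theta>f) tf (X, v)"
    using assms(2) unfolding OC_solution_def is_arg_min_def by blast
  then obtain a where trajX: "ae_trajectory tf X (\<lambda>t. dynamics (X t) (v t))"
    and "a > 0" and alpha: "\<And>t. t \<in> {0..tf} \<Longrightarrow> alpha (X t) = a"
    unfolding OC_feasible_def by auto
  obtain h where P12: "\<And>t. t \<in> {0..tf} \<Longrightarrow> fst (P t) = c1 \<and> fst (snd (P t)) = c2"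
    and trajP: "ae_trajectory tf P (\<lambda>t. adjoint_rhs l0 (X t, P t) (v t))"
    and \<mu>4_bd: "\<mu>4 0 = 0" "\<mu>4 tf = 0"
    and ham: "AE t in lebesgue_on {0..tf}. hamiltonian l0 (X t, P t) (v t) = h"
    using assms(3) unfolding OC_multipliers_def \<mu>4_def lam4_def by (auto simp: case_prod_beta)
  have X_eq: "X t = (fst (X t), fst (snd (X t)), \<theta> t, a)" if "t \<in> {0..tf}" for t
    using alpha[OF that] by (cases "X t") (simp add: \<theta>_def alpha_def)
  have P_eq: "P t = (c1, c2, \<mu>3 t, \<mu>4 t)" if "t \<in> {0..tf}" for t
    using P12[OF that] by (cases "P t") (simp add: \<mu>3_def \<mu>4_def)

  obtain LX LP where LX: "LX-lipschitz_on {0..tf} X" and LP: "LP-lipschitz_on {0..tf} P"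
    using trajX trajP unfolding ae_trajectory_def by auto
  have contX: "continuous_on {0..tf} X" and contP: "continuous_on {0..tf} P"
    using LX LP by (auto intro: lipschitz_on_continuous_on)
  have cont_\<theta>: "continuous_on {0..tf} \<theta>" and cont_\<mu>3: "continuous_on {0..tf} \<mu>3"
    unfolding \<theta>_def \<mu>3_def by (intro continuous_intros contX contP)+
  have cont_s: "continuous_on {\<zeta>1..\<zeta>2} s" and cont_q: "continuous_on {\<zeta>1..\<zeta>2} q"
    unfolding s_def q_def by (intro continuous_intros continuous_on_subset[OF cont_\<theta> arc])+
  have lip_\<mu>4: "LP-lipschitz_on {0..tf} \<mu>4"
  proof (rule lipschitz_onI)
    fix t u assume "t \<in> {0..tf}" "u \<in> {0..tf}"
    moreover have "dist (\<mu>4 t) (\<mu>4 u) \<le> dist (P t) (P u)"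
      unfolding \<mu>4_def by (meson dist_snd_le order_trans)
    ultimately show "dist (\<mu>4 t) (\<mu>4 u) \<le> LP * dist t u"
      using lipschitz_onD[OF LP] by fastforce
  qed (rule lipschitz_on_nonneg[OF LP])

  have d\<theta>: "AE t in lebesgue_on {0..tf}. (\<theta> has_real_derivative a * v t) (at t within {0..tf})"
  proof -
    have "(\<theta> has_real_derivative a * v t) (at t within {0..tf})"
      if "t \<in> {0..tf}" "(X has_vector_derivative dynamics (X t) (v t)) (at t within {0..tf})" for t
    proof -
      have "bounded_linear (\<lambda>z :: state. fst (snd (snd z)))"
        by (intro bounded_linear_intros)
      from bounded_linear.has_vector_derivative[OF this that(2)] show ?thesis
        unfolding has_real_derivative_iff_has_vector_derivative \<theta>_def
        by (subst (asm) X_eq[OF that(1)]) (simp add: dynamics_def)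
    qed
    then show ?thesis
      using trajX unfolding ae_trajectory_def AE_lebesgue_on_interval_iff_negligible
      by (auto elim!: negligible_subset)
  qed
  have dP: "AE t in lebesgue_on {0..tf}. (\<mu>3 has_real_derivative q t) (at t within {0..tf})
      \<and> (\<mu>4 has_real_derivative - 1 - \<mu>3 t * v t) (at t within {0..tf})"
  proof -
    have "(\<mu>3 has_real_derivative q t) (at t within {0..tf})
      \<and> (\<mu>4 has_real_derivative - 1 - \<mu>3 t * v t) (at t within {0..tf})"
      if "t \<in> {0..tf}"
        "(P has_vector_derivative adjoint_rhs l0 (X t, P t) (v t)) (at t within {0..tf})" for t
    proof -
      have rhs: "adjoint_rhs l0 (X t, P t) (v t) = (0, 0, q t, - 1 - \<mu>3 t * v t)"
        by (subst X_eq[OF that(1)], subst P_eq[OF that(1)])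
          (simp add: adjoint_rhs_def q_def assms(4))
      have "bounded_linear (\<lambda>z :: costate. fst (snd (snd z)))"
           "bounded_linear (\<lambda>z :: costate. snd (snd (snd z)))"
        by (intro bounded_linear_intros)+
      from this[THEN bounded_linear.has_vector_derivative, OF that(2)] show ?thesis
        unfolding has_real_derivative_iff_has_vector_derivative \<mu>3_def[abs_def] \<mu>4_def[abs_def]
        by (simp add: rhs \<mu>3_def)
    qed
    then show ?thesis
      using trajP unfolding ae_trajectory_def AE_lebesgue_on_interval_iff_negligible
      by (auto elim!: negligible_subset)
  qed
  have ham': "AE t in lebesgue_on {0..tf}. a + s t + a * \<mu>3 t * v t = h"
  proof -
    have "hamiltonian l0 (X t, P t) (v t) = a + s t + a * \<mu>3 t * v t" if "t \<in> {0..tf}" for t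
      by (subst X_eq[OF that], subst P_eq[OF that])
        (simp add: hamiltonian_def s_def assms(4))
    then show ?thesis
      using ham unfolding AE_lebesgue_on_interval_iff_negligible
      by (auto elim!: negligible_subset)
  qed

  have \<mu>3_0: "\<mu>3 t = 0" if "t \<in> {\<zeta>1..\<zeta>2}" for t
  proof (rule continuous_AE_const_imp_const[OF _ _ assms(7) that])
    show "AE t in lebesgue_on {\<zeta>1..\<zeta>2}. \<mu>3 t = 0"
      using assms(9) by (simp add: singular_over_def lam3_def \<mu>3_def case_prod_beta)
  qed (rule continuous_on_subset[OF cont_\<mu>3 arc])
  have interior: "AE t in lebesgue_on {\<zeta>1..\<zeta>2}. \<zeta>1 < t \<and> t < \<zeta>2"
  proof -
    have "{t\<in>{\<zeta>1..\<zeta>2}. \<not> (\<zeta>1 < t \<and> t < \<zeta>2)} \<subseteq> {\<zeta>1, \<zeta>2}"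
      by auto
    then show ?thesis
      unfolding AE_lebesgue_on_interval_iff_negligible
      by (rule negligible_subset[rotated]) (auto intro: negligible_finite)
  qed
  have q_0: "q t = 0" if "t \<in> {\<zeta>1..\<zeta>2}" for t
  proof (rule continuous_AE_const_imp_const[OF _ cont_q assms(7) that])
    show "AE t in lebesgue_on {\<zeta>1..\<zeta>2}. q t = 0"
      using interior AE_lebesgue_on_subinterval[OF dP arc]
    proof eventually_elim
      case (elim t)
      then show ?case
        by (intro zero_on_subinterval_imp_zero_deriv[OF _ arc, of \<mu>3 "q t" t])
          (auto simp: \<mu>3_0)
    qed
  qed
  \<comment> \<open>\<open>(s, q)\<close> is the vector \<open>(c1, - c2)\<close> rotated by the angle \<open>\<theta>\<close>.\<close>
  have sq: "s t ^ 2 + q t ^ 2 = \<rho>\<^sup>2" for t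
  proof -
    have "s t ^ 2 + q t ^ 2 = (c1\<^sup>2 + c2\<^sup>2) * ((sin (\<theta> t))\<^sup>2 + (cos (\<theta> t))\<^sup>2)"
      unfolding s_def q_def by (simp only: power2_eq_square) algebra
    then show ?thesis
      by (simp add: \<rho>_def cmod_def)
  qed
  have "\<rho> > 0"
    using assms(5) by (simp add: \<rho>_def)
  have s_le: "s t \<le> \<rho>" for t
    by (rule power2_le_imp_le) (use sq[of t] zero_le_power2[of "q t"] \<open>\<rho> > 0\<close> in linarith)+
  have s_cases: "s t = \<rho> \<or> s t = - \<rho>" if "t \<in> {\<zeta>1..\<zeta>2}" for t
    using sq[of t] q_0[OF that] by (simp add: power2_eq_iff)

  \<comment> \<open>The control drops out of the Hamiltonian on the arc, which ties the value of \<open>s\<close> there to the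
    constant \<open>h\<close> that governs the whole trajectory.\<close>
  have s_h: "s t = h - a" if "t \<in> {\<zeta>1..\<zeta>2}" for t
  proof (rule continuous_AE_const_imp_const[OF _ cont_s assms(7) that])
    show "AE t in lebesgue_on {\<zeta>1..\<zeta>2}. s t = h - a"
      using interior AE_lebesgue_on_subinterval[OF ham' arc]
      by eventually_elim (use \<mu>3_0 in fastforce)
  qed
  have s_neg: "s t < 0" if "t \<in> {\<zeta>1..\<zeta>2}" for t
  proof (rule ccontr)
    assume "\<not> s t < 0"
    then have h: "h = a + \<rho>"
      using s_cases[OF that] s_h[OF that] \<open>\<rho> > 0\<close> by auto
    have "AE t in lebesgue_on {0..tf}. \<exists>D<0. (\<mu>4 has_real_derivative D) (at t within {0..tf})"
      using dP ham'
    proof eventually_elim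
      case (elim t)
      \<comment> \<open>By the Hamiltonian identity \<open>a * \<lambda>\<^sub>4' = s t - h\<close>, with the present value of \<open>h\<close>.\<close>
      have "a * (- 1 - \<mu>3 t * v t) = s t - \<rho> - a"
        using elim h by (simp add: algebra_simps)
      also have "\<dots> < 0"
        using s_le[of t] \<open>a > 0\<close> by simp
      finally have "- 1 - \<mu>3 t * v t < 0"
        using \<open>a > 0\<close> by (simp add: mult_less_0_iff)
      then show ?case
        using elim by blast
    qed
    from lipschitz_strict_decrease[OF lip_\<mu>4 this \<open>tf > 0\<close>] show False
      using \<mu>4_bd by simp
  qed

  \<comment> \<open>The derivative of \<open>q = 0\<close> along the arc is \<open>s * \<theta>' = s * a * v\<close>.\<close>
  have v_0: "AE t in lebesgue_on {\<zeta>1..\<zeta>2}. v t = 0"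
    using interior AE_lebesgue_on_subinterval[OF d\<theta> arc]
  proof eventually_elim
    case (elim t)
    then have "(\<theta> has_real_derivative a * v t) (at t within {0..tf})"
      by simp
    then have "(q has_real_derivative s t * (a * v t)) (at t within {0..tf})"
      unfolding q_def[abs_def] s_def
      by (auto intro!: derivative_eq_intros simp: algebra_simps)
    then have "s t * (a * v t) = 0"
      by (rule zero_on_subinterval_imp_zero_deriv[OF _ arc]) (use elim q_0 in auto)
    then show ?case
      using s_neg[of t] elim \<open>a > 0\<close> by auto
  qed

  have Hv2: "Hv_deriv l0 2 (X t, P t) w = a\<^sup>2 * s t * w" if "t \<in> {\<zeta>1..\<zeta>2}" for t w
  proof -
    have t: "t \<in> {0..tf}"
      using that arc by blast
    show ?thesis
      by (subst X_eq[OF t], subst P_eq[OF t]) (simp only: Hv_deriv_2 s_def)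
  qed
  have "singular_order l0 X P {\<zeta>1..\<zeta>2} 1"
    unfolding singular_order_def
  proof (intro conjI allI impI ballI)
    fix j :: nat and z :: "state \<times> costate" and w w' assume "j < 2 * 1"
    then have "j = 0 \<or> j = 1" by auto
    moreover obtain x y \<theta>' \<alpha> l1 l2 l3 l4 where "z = ((x, y, \<theta>', \<alpha>), (l1, l2, l3, l4))"
      by (metis surj_pair)
    ultimately show "Hv_deriv l0 j z w = Hv_deriv l0 j z w'"
      by (auto simp only: Hv_deriv_0 Hv_deriv_1)
  next
    fix t assume t: "t \<in> {\<zeta>1..\<zeta>2}"
    have "Hv_deriv l0 2 (X t, P t) 0 \<noteq> Hv_deriv l0 2 (X t, P t) 1"
      unfolding Hv2[OF t] using s_neg[OF t] \<open>a > 0\<close> by simp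
    then show "\<exists>w w'. Hv_deriv l0 (2 * 1) (X t, P t) w \<noteq> Hv_deriv l0 (2 * 1) (X t, P t) w'"
      by (simp only: mult_1_right) blast
  qed
  moreover have "generalized_Legendre_Clebsch l0 X v P {\<zeta>1..\<zeta>2} 1"
    unfolding generalized_Legendre_Clebsch_def
  proof
    fix t assume t: "t \<in> {\<zeta>1..\<zeta>2}"
    have "Hv_deriv l0 2 (X t, P t) = (\<lambda>w. a\<^sup>2 * s t * w)"
      using Hv2[OF t] by blast
    moreover have "((\<lambda>w. a\<^sup>2 * s t * w) has_real_derivative a\<^sup>2 * s t) (at (v t))"
      by (auto intro!: derivative_eq_intros)
    ultimately have "deriv (Hv_deriv l0 2 (X t, P t)) (v t) = a\<^sup>2 * s t"
      by (simp only: DERIV_imp_deriv)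
    moreover have "a\<^sup>2 * s t \<le> 0"
      using s_neg[OF t] by (simp add: mult_nonneg_nonpos)
    ultimately show "(- 1) ^ 1 * deriv (Hv_deriv l0 (2 * 1) (X t, P t)) (v t) \<ge> 0"
      by (simp only: mult_1_right power_one_right)
  qed
  ultimately show ?thesis
    using v_0 by blast
qed

end
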